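(* Let $G$ be a finite simple connected graph with maximum degree $\Delta(G)=4$. Suppose that $G$ contains five distinct vertices $x,y,z,u,v$ such that $xy,\,xz,\,yz,\,yu,\,uv\in E(G)$, with $d_G(x)=d_G(z)=d_G(v)=3$ and $d_G(y)=d_G(u)=4$. Let $e=xy$. If $\chi'(G-e)=4$, then $\chi'(G)=4$.
   Context: $d_G(a)$ denotes the degree of the vertex $a$ in $G$. $\chi'(G)$ denotes the chromatic index, the least $k$ such that $G$ has a proper $k$-edge-coloring. $G-e$ is the graph obtained from $G$ by deleting the edge $e$ (keeping all vertices). The listed edges are required to be present; further edges of $G$ among the listed vertices are allowed subject to the degree conditions (the configuration is not required to be induced). *)

theory Defs
  imports "Graph_Theory.Graph_Theory"
begin

text \<open>
  A finite simple graph is a \<^locale>\<open>pair_graph\<close>: a finite, loop-free, symmetric set of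
  pairs, where the undirected edge between \<open>a\<close> and \<open>b\<close> is represented by both arcs
  \<open>(a, b)\<close> and \<open>(b, a)\<close>. The degree of a vertex is therefore its
  \<^const>\<open>out_degree\<close> (which equals its \<^const>\<open>in_degree\<close>).
\<close>

definition edges :: "'a pair_pre_digraph \<Rightarrow> 'a set set" where
  "edges G = {{a, b} | a b. (a, b) \<in> parcs G}"

definition max_degree :: "'a pair_pre_digraph \<Rightarrow> nat" where
  "max_degree G = Max (out_degree (with_proj G) ` pverts G)"

definition del_edge :: "'a pair_pre_digraph \<Rightarrow> 'a set \<Rightarrow> 'a pair_pre_digraph" where
  "del_edge G e = \<lparr>pverts = pverts G, parcs = {(a, b) \<in> parcs G. {a, b} \<noteq> e}\<rparr>"

definition proper_edge_coloring :: "'a pair_pre_digraph \<Rightarrow> nat \<Rightarrow> ('a set \<Rightarrow> nat) \<Rightarrow> bool" where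
  "proper_edge_coloring G k c \<longleftrightarrow>
     (\<forall>e\<in>edges G. c e < k) \<and>
     (\<forall>e\<in>edges G. \<forall>f\<in>edges G. e \<noteq> f \<and> e \<inter> f \<noteq> {} \<longrightarrow> c e \<noteq> c f)"

definition chromatic_index :: "'a pair_pre_digraph \<Rightarrow> nat" where
  "chromatic_index G = (LEAST k. \<exists>c. proper_edge_coloring G k c)"

lemma pair_graph_del_edge:
  assumes "pair_graph G"
  shows "pair_graph (del_edge G e)"
proof -
  interpret pair_graph G by fact
  have "finite {(a, b) \<in> parcs G. {a, b} \<noteq> e}"
    by (rule finite_subset[OF _ pair_finite_arcs]) auto
  then show ?thesis
    by unfold_locales
      (auto simp: del_edge_def pair_finite_verts symmetric_def insert_commute
        dest: in_arcsD1 in_arcsD2 no_loops' intro!: symI intro: arcs_symmetric)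
qed

lemma edges_del_edge: "edges (del_edge G e) = edges G - {e}"
  by (auto simp: edges_def del_edge_def)

lemma out_degree_eq_card_edges:
  assumes "pair_graph G"
  shows "out_degree (with_proj G) v = card {e \<in> edges G. v \<in> e}"
proof -
  interpret pair_graph G by fact
  have "{e \<in> edges G. v \<in> e} = (\<lambda>(a, b). {a, b}) ` out_arcs (with_proj G) v"
    by (fastforce simp: edges_def out_arcs_def intro: arcs_symmetric)
  moreover have "inj_on (\<lambda>(a, b). {a, b}) (out_arcs (with_proj G) v)"
    by (auto simp: inj_on_def out_arcs_def doubleton_eq_iff)
  ultimately show ?thesis
    by (simp add: out_degree_def card_image)
qed

lemma chromatic_index_attained:
  assumes "pair_graph G"
  shows "\<exists>c. proper_edge_coloring G (chromatic_index G) c"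
proof -
  interpret pair_graph G by fact
  have "edges G = (\<lambda>(a, b). {a, b}) ` parcs G"
    by (auto simp: edges_def)
  then have "finite (edges G)"
    using pair_finite_arcs by simp
  then obtain c :: "'a set \<Rightarrow> nat" and k where "c ` edges G = {..<k}" "inj_on c (edges G)"
    using finite_imp_inj_to_nat_seg[of "edges G"] by (auto simp: lessThan_def)
  then have "proper_edge_coloring G k c"
    by (auto simp: proper_edge_coloring_def inj_on_def)
  then show ?thesis
    unfolding chromatic_index_def
    by (intro LeastI[of "\<lambda>k. \<exists>c. proper_edge_coloring G k c" k]) blast
qed

end

theory Submission
  imports Defs "HOL-Combinatorics.Transposition"
begin

text \<open>
  Delete the five edges \<open>xy, xz, yz, yu, uv\<close> and cut the rest of the graph open at
  \<open>x, z, y, u, v\<close>, which leaves seven half-edges. In any 4-colouring of the rest,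
  the components formed by two colours \<open>\<alpha>, \<beta>\<close> are paths and cycles, so they match the
  half-edges coloured \<open>\<alpha>\<close> or \<open>\<beta>\<close> in pairs or leave them unmatched, and each component may be
  swapped independently. Whatever these matchings are, every boundary colouring that extends to
  \<open>G - xy\<close> can be turned by at most four rounds of swaps into one that extends to \<open>G\<close>: the
  configuration is D-reducible in the sense of the four colour problem. Up to symmetry only 16
  boundary colourings need a swap, and they are settled by a finite computation.
\<close>

subsection \<open>Words of boundary colours\<close>

text \<open>A word lists the colours of the half-edges leaving the configuration, in the order
  of their inner ends \<open>x, z, y, u, u, v, v\<close>.\<close>

definition free :: "nat list \<Rightarrow> nat list" where
  "free cs = filter (\<lambda>i. i \<notin> set cs) [0, 1, 2, 3]"

text \<open>Each of \<open>xz\<close>, \<open>yz\<close>, \<open>yu\<close>, \<open>uv\<close> is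
  tested only against half-edges and edges chosen before it; \<open>uv\<close> constrains no later
  choice, so it is left as a nonemptiness test.\<close>

fun extendable :: "nat list \<Rightarrow> bool" where
  "extendable [sx, sz, sy, u1, u2, v1, v2] \<longleftrightarrow> u1 \<noteq> u2 \<and> v1 \<noteq> v2 \<and>
     (\<exists>xz \<in> set (free [sx, sz]). \<exists>yz \<in> set (free [sz, xz, sy]).
      \<exists>yu \<in> set (free [sy, yz, u1, u2]). set (free [yu, u1, u2, v1, v2]) \<noteq> {})"
| "extendable _ \<longleftrightarrow> False"

text \<open>The edges \<open>xy\<close> and \<open>uv\<close> share no end, so once
  \<open>xz\<close>, \<open>yz\<close>, \<open>yu\<close> are fixed, their colours are sought
  independently.\<close>

fun completable :: "nat list \<Rightarrow> bool" where
  "completable [sx, sz, sy, u1, u2, v1, v2] \<longleftrightarrow> u1 \<noteq> u2 \<and> v1 \<noteq> v2 \<and>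
     (\<exists>xz \<in> set (free [sx, sz]). \<exists>yz \<in> set (free [sz, xz, sy]).
      \<exists>yu \<in> set (free [sy, yz, u1, u2]). set (free [yu, u1, u2, v1, v2]) \<noteq> {} \<and>
        set (free [sx, xz, sy, yz, yu]) \<noteq> {})"
| "completable _ \<longleftrightarrow> False"

definition flip :: "nat \<Rightarrow> nat \<Rightarrow> nat list \<Rightarrow> nat list \<Rightarrow> nat list" where
  "flip \<alpha> \<beta> T w = map (\<lambda>(n, i). if n \<in> set T then transpose \<alpha> \<beta> i else i) (zip [0..<length w] w)"

text \<open>The two-coloured chains are revealed one at a time: the chain of the half-edge \<open>i\<close> ends
  either outside the configuration or at another half-edge \<open>j\<close> of \<open>A\<close>, and only then do we
  decide whether to swap it. A single such query is not enough for this configuration; the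
  pairing of the later half-edges has to be known as well.\<close>

function kempe :: "(nat list \<Rightarrow> bool) \<Rightarrow> nat \<Rightarrow> nat \<Rightarrow> nat list \<Rightarrow> nat list \<Rightarrow> bool" where
  "kempe W \<alpha> \<beta> [] w \<longleftrightarrow> W w"
| "kempe W \<alpha> \<beta> (i # A) w \<longleftrightarrow>
     (kempe W \<alpha> \<beta> A w \<or> kempe W \<alpha> \<beta> A (flip \<alpha> \<beta> [i] w)) \<and>
     (\<forall>j \<in> set A. kempe W \<alpha> \<beta> (remove1 j A) w \<or>
        kempe W \<alpha> \<beta> (remove1 j A) (flip \<alpha> \<beta> [i, j] w))"
  by pat_completeness auto
termination
  by (relation "measure (\<lambda>(_, _, _, A, _). length A)") (auto simp: length_remove1)

definition reduces :: "(nat list \<Rightarrow> bool) \<Rightarrow> nat \<Rightarrow> nat \<Rightarrow> nat list \<Rightarrow> bool" where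
  "reduces W \<alpha> \<beta> w \<longleftrightarrow>
     kempe W \<alpha> \<beta> (filter (\<lambda>n. w ! n \<in> {\<alpha>, \<beta>}) [0..<length w]) w"

text \<open>Colours are renamed in the order of their first occurrence, \<open>k\<close> of them being already
  named.\<close>

fun canonical :: "nat \<Rightarrow> nat list \<Rightarrow> nat list" where
  "canonical k [] = []"
| "canonical k (i # w) =
     (if i < k then i # canonical k w else k # canonical (Suc k) (map (transpose i k) w))"

text \<open>For \<open>k = 0\<close> these are the restricted growth strings over four letters, one
  for each partition of the positions into at most four classes.\<close>

fun canonical_words :: "nat \<Rightarrow> nat \<Rightarrow> nat list list" where
  "canonical_words k 0 = [[]]"
| "canonical_words k (Suc n) =
     concat (map (\<lambda>i. map ((#) i) (canonical_words (max k (Suc i)) n)) [0..<min 4 (Suc k)])"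

text \<open>The two half-edges at \<open>u\<close>, and likewise those at \<open>v\<close>, play
  symmetric roles. The type is polymorphic because \<open>realizable_variants\<close> reorders the
  half-edges themselves in the same way.\<close>

fun variants :: "'b list \<Rightarrow> 'b list list" where
  "variants [sx, sz, sy, u1, u2, v1, v2] =
    [[sx, sz, sy, u1, u2, v1, v2], [sx, sz, sy, u2, u1, v1, v2],
     [sx, sz, sy, u1, u2, v2, v1], [sx, sz, sy, u2, u1, v2, v1]]"
| "variants w = [w]"

definition won :: "(nat list \<times> nat \<times> nat) list \<Rightarrow> nat list \<Rightarrow> bool" where
  "won L w \<longleftrightarrow> completable w \<or>
     (\<exists>w' \<in> set (variants w). \<exists>(v, _) \<in> set L. v = canonical 0 w')"

fun winning :: "(nat list \<times> nat \<times> nat) list \<Rightarrow> bool" where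
  "winning [] \<longleftrightarrow> True"
| "winning ((w, \<alpha>, \<beta>) # L) \<longleftrightarrow> \<alpha> < 4 \<and> \<beta> < 4 \<and> \<alpha> \<noteq> \<beta> \<and> reduces (won L) \<alpha> \<beta> w \<and> winning L"

text \<open>Found by a computer search. The words are, up to \<^const>\<open>variants\<close> and renaming of colours,
  exactly those that extend to \<open>G - xy\<close> but not to \<open>G\<close>; each is reduced, by swaps of its two
  colours, to words that extend to \<open>G\<close> or that come later in the list.\<close>

definition strategy :: "(nat list \<times> nat \<times> nat) list" where
  "strategy =
   [([0, 1, 1, 2, 3, 2, 3], 0, 2),
    ([0, 1, 0, 2, 3, 2, 3], 1, 2),
    ([0, 1, 0, 2, 3, 1, 2], 0, 3),
    ([0, 1, 1, 2, 3, 0, 2], 1, 3),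
    ([0, 1, 1, 1, 2, 0, 2], 1, 2),
    ([0, 1, 0, 0, 2, 1, 2], 0, 2),
    ([0, 0, 1, 1, 2, 2, 3], 0, 3),
    ([0, 0, 1, 0, 1, 0, 2], 0, 2),
    ([0, 0, 1, 0, 2, 0, 3], 0, 1),
    ([0, 0, 1, 0, 1, 0, 1], 0, 2),
    ([0, 0, 1, 0, 2, 2, 3], 0, 1),
    ([0, 1, 0, 0, 2, 0, 1], 1, 2),
    ([0, 0, 1, 0, 2, 0, 2], 0, 3),
    ([0, 1, 1, 1, 2, 0, 1], 0, 2),
    ([0, 0, 1, 0, 1, 1, 2], 0, 2),
    ([0, 0, 1, 1, 2, 1, 3], 0, 3)]"

lemma winning_strategy: "winning strategy"
  by code_simp

text \<open>Canonical words suffice because the colours of a given colouring may be renamed first.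
  Together with \<open>winning_strategy\<close> this is the whole finite computation.\<close>

lemma extendable_won: "\<forall>w \<in> set (canonical_words 0 7). extendable w \<longrightarrow> won strategy w"
  by code_simp

subsection \<open>Kempe chains\<close>

text \<open>A walk becomes a simple path by discarding the detour whenever it returns to a
  vertex.\<close>

lemma rtranclp_distinct_path:
  assumes "R\<^sup>*\<^sup>* a b"
  shows "\<exists>p. p \<noteq> [] \<and> hd p = a \<and> last p = b \<and> distinct p \<and> successively R p"
  using assms
proof (induction rule: converse_rtranclp_induct)
  case base
  show ?case by (rule exI[of _ "[b]"]) simp
next
  case (step a c)
  then obtain p where p: "p \<noteq> []" "hd p = c" "last p = b" "distinct p" "successively R p"
    by blast
  show ?case
  proof (cases "a \<in> set p")
    case True
    then obtain ys zs where "p = ys @ a # zs" by (meson split_list)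
    with p show ?thesis
      by (intro exI[of _ "a # zs"]) (auto simp: successively_append_iff)
  next
    case False
    with p step.hyps show ?thesis
      by (intro exI[of _ "a # p"]) (cases p; auto)
  qed
qed

text \<open>A simple path joining two ends already exhausts its connected component.\<close>

lemma at_most_two_ends:
  assumes sym: "symp R"
    and deg: "\<And>a b c d. R a b \<Longrightarrow> R a c \<Longrightarrow> R a d \<Longrightarrow> \<not> distinct [b, c, d]"
    and ends: "\<And>a b c. a \<in> {h, k, l} \<Longrightarrow> R a b \<Longrightarrow> R a c \<Longrightarrow> b = c"
    and "R\<^sup>*\<^sup>* h k" "R\<^sup>*\<^sup>* h l"
  shows "\<not> distinct [h, k, l]"
proof
  assume dist: "distinct [h, k, l]"
  obtain p where p: "p \<noteq> []" "hd p = h" "last p = k" "distinct p" "successively R p"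
    using rtranclp_distinct_path[OF \<open>R\<^sup>*\<^sup>* h k\<close>] by blast
  have next_R: "R (p ! n) (p ! Suc n)" if "Suc n < length p" for n
    using p(5) that by (simp add: successively_conv_nth)
  have prev_R: "R (p ! Suc n) (p ! n)" if "Suc n < length p" for n
    using sympD[OF sym next_R[OF that]] .
  have first: "p ! 0 = h" and final: "p ! (length p - 1) = k"
    using p by (simp_all add: hd_conv_nth last_conv_nth)
  have inner: "\<exists>m. n = Suc m \<and> Suc n < length p" if "n < length p" "p ! n \<notin> {h, k}" for n
  proof -
    have "n \<noteq> 0" "n \<noteq> length p - 1"
      using that first final by (metis insertCI)+
    with that show ?thesis by (cases n) auto
  qed
  have neighbours: "p ! m \<noteq> p ! Suc (Suc m)" if "Suc (Suc m) < length p" for m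
    using that p(4) by (simp add: nth_eq_iff_index_eq)
  \<comment> \<open>The path cannot be left: its two ends have a single neighbour by
    \<open>ends\<close>, an inner vertex has at most two by \<open>deg\<close>, and these are
    already the adjacent path vertices.\<close>
  have closed: "b \<in> set p" if a: "a \<in> set p" and "R a b" for a b
  proof -
    obtain n where n: "n < length p" "a = p ! n"
      using a by (metis in_set_conv_nth)
    have long: "Suc 0 < length p"
      using first final dist p(1) by (cases p) auto
    consider "n = 0" | "n = length p - 1" | m where "n = Suc m" "Suc n < length p"
      using n by (cases n) (auto, fastforce)
    then show ?thesis
    proof cases
      case 1
      then have "b = p ! Suc 0"
        using ends[of h b "p ! Suc 0"] next_R[of 0] long n first \<open>R a b\<close> by simp
      with long show ?thesis by simp
    next
      case 2
      then have "b = p ! (length p - 2)"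
        using ends[of k b "p ! (length p - 2)"] prev_R[of "length p - 2"] long n final \<open>R a b\<close>
        by (simp add: numeral_2_eq_2 Suc_diff_Suc)
      with long show ?thesis by simp
    next
      case 3
      then have "b \<in> {p ! m, p ! Suc n}"
        using deg[of a b "p ! m" "p ! Suc n"] next_R[of n] prev_R[of m] neighbours[of m] n \<open>R a b\<close>
        by auto
      with 3 show ?thesis by auto
    qed
  qed
  have "h \<in> set p"
    using p by force
  \<comment> \<open>As \<open>l\<close> differs from \<open>h\<close> and \<open>k\<close>, it is
    then an inner vertex, and its two different neighbours contradict \<open>ends\<close>.\<close>
  have "l \<in> set p"
    using \<open>R\<^sup>*\<^sup>* h l\<close> by induction (use \<open>h \<in> set p\<close> closed in auto)
  then obtain n where n: "n < length p" "p ! n = l"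
    by (metis in_set_conv_nth)
  then obtain m where m: "n = Suc m" "Suc n < length p"
    using inner[of n] dist by auto
  show False
    using ends[of l "p ! m" "p ! Suc n"] next_R[of n] prev_R[of m] neighbours[of m] n m by auto
qed

text \<open>Edges are not compared at the vertices of \<open>I\<close>: the graph is cut open there, so that
  every half-edge at \<open>I\<close> is the end of a chain.\<close>

definition proper_off :: "('a \<times> 'a) set \<Rightarrow> 'a set \<Rightarrow> nat \<Rightarrow> ('a set \<Rightarrow> nat) \<Rightarrow> bool" where
  "proper_off D I k c \<longleftrightarrow> (\<forall>(a, b) \<in> D. c {a, b} < k) \<and>
     (\<forall>a b b'. a \<notin> I \<longrightarrow> (a, b) \<in> D \<longrightarrow> (a, b') \<in> D \<longrightarrow> b \<noteq> b' \<longrightarrow> c {a, b} \<noteq> c {a, b'})"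

lemma proper_off_comp:
  assumes "proper_off D I k c" "inj \<pi>" "\<And>i. i < k \<Longrightarrow> \<pi> i < k"
  shows "proper_off D I k (\<pi> \<circ> c)"
  using assms by (fastforce simp: proper_off_def inj_eq)

text \<open>Chains run through darts, so that a dart with tail in \<open>I\<close> can only be
  reversed and is an end of its chain. An edge of \<open>D\<close> between two vertices of the
  configuration thus counts as two half-edges, linked to each other by reversal.\<close>

definition chain :: "'a set \<Rightarrow> ('a \<times> 'a) set \<Rightarrow> 'a \<times> 'a \<Rightarrow> 'a \<times> 'a \<Rightarrow> bool" where
  "chain I X d d' \<longleftrightarrow> d \<in> X \<and> d' \<in> X \<and>
     (d' = prod.swap d \<or> fst d \<notin> I \<and> fst d' = fst d \<and> d' \<noteq> d)"

definition bicolored :: "('a \<times> 'a) set \<Rightarrow> ('a set \<Rightarrow> nat) \<Rightarrow> nat \<Rightarrow> nat \<Rightarrow> ('a \<times> 'a) set" where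
  "bicolored D c \<alpha> \<beta> = {(a, b) \<in> D. c {a, b} \<in> {\<alpha>, \<beta>}}"

definition kempe_swap :: "('a \<times> 'a) set \<Rightarrow> nat \<Rightarrow> nat \<Rightarrow> ('a set \<Rightarrow> nat) \<Rightarrow> 'a set \<Rightarrow> nat" where
  "kempe_swap S \<alpha> \<beta> c e =
     (if \<exists>a b. e = {a, b} \<and> (a, b) \<in> S then transpose \<alpha> \<beta> (c e) else c e)"

definition word :: "('a \<times> 'a) list \<Rightarrow> ('a set \<Rightarrow> nat) \<Rightarrow> nat list" where
  "word hs c = map (\<lambda>(a, b). c {a, b}) hs"

section \<open>Two-coloured chains of a colouring and their swaps\<close>

lemma mem_bicolored: "d \<in> bicolored D c \<alpha> \<beta> \<longleftrightarrow> d \<in> D \<and> c {fst d, snd d} \<in> {\<alpha>, \<beta>}"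
  by (auto simp: bicolored_def)

lemma symp_chain: "symp (chain I X)"
  by (auto simp: chain_def intro!: sympI)

text \<open>Properness off \<open>I\<close> leaves at most two darts of colours \<alpha>, \<beta>
  with a given tail outside \<open>I\<close>. A dart therefore has at most two neighbours in its
  chain, namely its reversal and one turn at its tail.\<close>

lemma chain_ends:
  assumes c: "proper_off D I k c"
    and "fst h1 \<in> I" "fst h2 \<in> I" "fst h3 \<in> I"
    and "(chain I (bicolored D c \<alpha> \<beta>))\<^sup>*\<^sup>* h1 h2" "(chain I (bicolored D c \<alpha> \<beta>))\<^sup>*\<^sup>* h1 h3"
  shows "\<not> distinct [h1, h2, h3]"
proof (rule at_most_two_ends[OF symp_chain _ _ assms(5,6)])
  let ?X = "bicolored D c \<alpha> \<beta>"
  show "b = d" if "a \<in> {h1, h2, h3}" "chain I ?X a b" "chain I ?X a d" for a b d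
    using that assms(2-4) by (auto simp: chain_def)
  have inj: "b = b'" if "a \<notin> I" "(a, b) \<in> D" "(a, b') \<in> D" "c {a, b} = c {a, b'}" for a b b'
    using c that unfolding proper_off_def by blast
  have two: "\<not> distinct [b1, b2, b3]"
    if "a \<notin> I" "(a, b1) \<in> ?X" "(a, b2) \<in> ?X" "(a, b3) \<in> ?X" for a b1 b2 b3
    using that inj[OF that(1)] unfolding bicolored_def by auto
  show "\<not> distinct [b, d, e]" if "chain I ?X a b" "chain I ?X a d" "chain I ?X a e" for a b d e
  proof -
    obtain a1 a2 b1 b2 d1 d2 e1 e2 where [simp]: "a = (a1, a2)" "b = (b1, b2)" "d = (d1, d2)" "e = (e1, e2)"
      by (metis surj_pair)
    show ?thesis
      using that two[of a1 a2 b2 d2] two[of a1 a2 b2 e2] two[of a1 a2 d2 e2]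
      by (auto simp: chain_def)
  qed
qed

lemma kempe_swap_dart:
  assumes "sym S"
  shows "kempe_swap S \<alpha> \<beta> c {a, b} = (if (a, b) \<in> S then transpose \<alpha> \<beta> (c {a, b}) else c {a, b})"
  using symD[OF assms] unfolding kempe_swap_def by (auto simp: doubleton_eq_iff)

lemma bicolored_kempe_swap:
  assumes "sym S"
  shows "bicolored D (kempe_swap S \<alpha> \<beta> c) \<alpha> \<beta> = bicolored D c \<alpha> \<beta>"
  using assms by (auto simp: bicolored_def kempe_swap_dart transpose_def split: if_splits)

text \<open>By closure, the darts coloured \<alpha> or \<beta> at a vertex outside \<open>I\<close>
  are all in \<open>S\<close> or all outside it, so both colours are exchanged there or
  neither.\<close>

lemma proper_off_kempe_swap:
  assumes c: "proper_off D I k c" and "sym S" "\<alpha> < k" "\<beta> < k"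
    and S: "S \<subseteq> bicolored D c \<alpha> \<beta>"
    and closed: "\<And>d d'. d \<in> S \<Longrightarrow> chain I (bicolored D c \<alpha> \<beta>) d d' \<Longrightarrow> d' \<in> S"
  shows "proper_off D I k (kempe_swap S \<alpha> \<beta> c)"
  unfolding proper_off_def
proof (intro conjI allI impI ballI)
  fix d assume "d \<in> D"
  then show "case d of (a, b) \<Rightarrow> kempe_swap S \<alpha> \<beta> c {a, b} < k"
    using c assms(2-4) by (auto simp: proper_off_def kempe_swap_dart transpose_def split: prod.splits)
next
  fix a b b' assume *: "a \<notin> I" "(a, b) \<in> D" "(a, b') \<in> D" "b \<noteq> b'"
  then have ne: "c {a, b} \<noteq> c {a, b'}"
    using c unfolding proper_off_def by blast
  have aux: "c {a, b2} \<notin> {\<alpha>, \<beta>}"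
    if "(a, b1) \<in> S" "(a, b2) \<notin> S" "(a, b2) \<in> D" "b1 \<noteq> b2" for b1 b2
    using that closed[of "(a, b1)" "(a, b2)"] S \<open>a \<notin> I\<close> by (auto simp: chain_def bicolored_def)
  have mem: "c {a, b1} \<in> {\<alpha>, \<beta>}" if "(a, b1) \<in> S" for b1
    using that S by (auto simp: bicolored_def)
  show "kempe_swap S \<alpha> \<beta> c {a, b} \<noteq> kempe_swap S \<alpha> \<beta> c {a, b'}"
    using * ne aux[of b b'] aux[of b' b] mem[of b] mem[of b'] \<open>sym S\<close>
    by (auto simp: kempe_swap_dart transpose_def)
qed


section \<open>Playing the queries of \<open>kempe\<close> on an actual colouring\<close>

lemma length_flip [simp]: "length (flip \<alpha> \<beta> T w) = length w"
  by (simp add: flip_def)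

lemma nth_flip:
  "n < length w \<Longrightarrow> flip \<alpha> \<beta> T w ! n = (if n \<in> set T then transpose \<alpha> \<beta> (w ! n) else w ! n)"
  by (simp add: flip_def)

lemma length_word [simp]: "length (word hs c) = length hs"
  by (simp add: word_def)

lemma nth_word: "n < length hs \<Longrightarrow> word hs c ! n = c {fst (hs ! n), snd (hs ! n)}"
  by (simp add: word_def case_prod_beta)

text \<open>The colouring itself answers each query with the true partner of the half-edge. Swaps
  preserve the set \<open>X\<close> of darts coloured \<alpha> or \<beta>, so the chains stay the
  same throughout the induction; \<open>A\<close> holds the unresolved half-edges and is closed
  under chains.\<close>

lemma kempe_sound:
  assumes "sym D" "\<alpha> < k" "\<beta> < k"
    and hs: "distinct hs" "set hs \<subseteq> D" "fst ` set hs \<subseteq> I"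
    and "proper_off D I k c" "bicolored D c \<alpha> \<beta> = X"
    and "distinct A" "\<And>i. i \<in> set A \<Longrightarrow> i < length hs \<and> hs ! i \<in> X"
    and "\<And>i j. i \<in> set A \<Longrightarrow> j < length hs \<Longrightarrow> (chain I X)\<^sup>*\<^sup>* (hs ! i) (hs ! j) \<Longrightarrow> j \<in> set A"
    and "kempe W \<alpha> \<beta> A (word hs c)"
  shows "\<exists>c'. proper_off D I k c' \<and> W (word hs c')"
  using assms(7-)
proof (induction "length A" arbitrary: A c rule: less_induct)
  case less
  note c = less.prems(1) and X = less.prems(2) and A = less.prems(3,4) and comp = less.prems(5)
    and kempe = less.prems(6)
  show ?case
  proof (cases A)
    case Nil
    with c kempe show ?thesis by auto
  next
    case (Cons i B)
    define S where "S = {d. (chain I X)\<^sup>*\<^sup>* (hs ! i) d}"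
    define T where "T = {j. j < length hs \<and> hs ! j \<in> S}"
    have i: "i < length hs" "hs ! i \<in> X"
      using A Cons by auto
    have "sym X"
      using \<open>sym D\<close> X by (auto simp: bicolored_def sym_def insert_commute)
    have "d \<in> X" if "d \<in> S" for d
      using that i unfolding S_def mem_Collect_eq by induction (auto simp: chain_def)
    then have "S \<subseteq> X" by blast
    have closed: "d' \<in> S" if "d \<in> S" "chain I X d d'" for d d'
      using that unfolding S_def by auto
    have "sym S"
    proof (rule symI)
      fix a b assume ab: "(a, b) \<in> S"
      with \<open>S \<subseteq> X\<close> \<open>sym X\<close> have "chain I X (a, b) (b, a)"
        by (auto simp: chain_def dest: symD)
      with ab closed show "(b, a) \<in> S" by blast
    qed
    define c' where "c' = kempe_swap S \<alpha> \<beta> c"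
    have c': "proper_off D I k c'"
      unfolding c'_def using proper_off_kempe_swap[OF c \<open>sym S\<close>] \<open>S \<subseteq> X\<close> closed X assms(2,3) by blast
    have X': "bicolored D c' \<alpha> \<beta> = X"
      unfolding c'_def using bicolored_kempe_swap[OF \<open>sym S\<close>] X by metis
    have word': "word hs c' = flip \<alpha> \<beta> js (word hs c)" if "set js = T" for js
      using that \<open>sym S\<close>
      by (intro nth_equalityI) (auto simp: nth_flip nth_word c'_def kempe_swap_dart T_def)
    have T_A: "T \<subseteq> set A"
      using comp[of i] Cons by (auto simp: T_def S_def)
    have "i \<in> T"
      using i by (auto simp: T_def S_def)
    \<comment> \<open>By \<open>chain_ends\<close> a chain meets at most two half-edges, so
      \<open>T\<close> is \<open>{i}\<close> or \<open>{i, j}\<close>: the two cases of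
      \<open>kempe\<close>.\<close>
    have pair: "\<not> distinct [i, j, l]" if "j \<in> T" "l \<in> T" for j l
    proof -
      have "\<not> distinct [hs ! i, hs ! j, hs ! l]"
      proof (rule chain_ends[OF c])
        show "fst (hs ! i) \<in> I" "fst (hs ! j) \<in> I" "fst (hs ! l) \<in> I"
          using that i hs(3) by (auto simp: T_def)
      qed (use that X in \<open>auto simp: T_def S_def\<close>)
      then show ?thesis
        using that i hs(1) by (auto simp: T_def nth_eq_iff_index_eq)
    qed
    \<comment> \<open>Removing \<open>T\<close> removes all ends of one chain, so the remaining
      positions are still closed under chains and the induction hypothesis applies to
      \<open>c\<close> and to \<open>c'\<close>.\<close>
    have recurse: ?thesis if "set A' = set A - T" "distinct A'" "length A' < length A"
      "kempe W \<alpha> \<beta> A' (word hs c) \<or> kempe W \<alpha> \<beta> A' (word hs c')" for A'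
    proof -
      have comp': "n \<in> set A'" if "m \<in> set A'" "n < length hs" "(chain I X)\<^sup>*\<^sup>* (hs ! m) (hs ! n)" for m n
      proof -
        have "n \<notin> T"
        proof
          assume "n \<in> T"
          have "(chain I X)\<^sup>*\<^sup>* (hs ! n) (hs ! m)"
            using that(3) symp_chain[of I X] by (meson symp_rtranclp sympD)
          with \<open>n \<in> T\<close> have "(chain I X)\<^sup>*\<^sup>* (hs ! i) (hs ! m)"
            unfolding T_def S_def by auto
          with that(1) A(2)[of m] have "m \<in> T"
            by (auto simp: T_def S_def \<open>set A' = set A - T\<close>)
          with that(1) \<open>set A' = set A - T\<close> show False by blast
        qed
        with comp[of m n] that \<open>set A' = set A - T\<close> show ?thesis by blast
      qed
      show ?thesis
        using that(4) less.hyps[OF that(3) c X that(2) _ comp'] less.hyps[OF that(3) c' X' that(2) _ comp']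
          A(2) that(1) by auto
    qed
    show ?thesis
    proof (cases "T = {i}")
      case True
      show ?thesis
        by (rule recurse[of B]) (use A(1) Cons True kempe word'[of "[i]"] in auto)
    next
      case False
      then obtain j where j: "j \<in> T" "j \<noteq> i"
        using \<open>i \<in> T\<close> by blast
      then have "T = {i, j}"
        using pair[OF j(1)] \<open>i \<in> T\<close> by auto
      moreover have "j \<in> set B"
        using j T_A Cons by auto
      ultimately show ?thesis
        by (intro recurse[of "remove1 j B"])
          (use A(1) Cons kempe word'[of "[i, j]"] in \<open>auto simp: length_remove1\<close>)
    qed
  qed
qed

subsection \<open>Soundness of the strategy\<close>

text \<open>Only the tails of the half-edges are prescribed, so exchanging the two at
  \<open>u\<close> or at \<open>v\<close> gives another realization over the same
  \<open>vs\<close>.\<close>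

definition realizable :: "('a \<times> 'a) set \<Rightarrow> 'a set \<Rightarrow> 'a list \<Rightarrow> nat list \<Rightarrow> bool" where
  "realizable D I vs w \<longleftrightarrow> (\<exists>hs c. map fst hs = vs \<and> distinct hs \<and> set hs \<subseteq> D \<and>
     proper_off D I 4 c \<and> w = word hs c)"

lemma realizableE:
  assumes "realizable D I vs w"
  obtains hs c where "map fst hs = vs" "distinct hs" "set hs \<subseteq> D" "proper_off D I 4 c" "w = word hs c"
  using assms unfolding realizable_def by auto

lemma realizable_reduces:
  assumes "sym D" "set vs \<subseteq> I" "\<alpha> < 4" "\<beta> < 4"
    and w: "realizable D I vs w" "reduces W \<alpha> \<beta> w"
  shows "\<exists>w'. realizable D I vs w' \<and> W w'"
proof -
  obtain hs c where hs: "map fst hs = vs" "distinct hs" "set hs \<subseteq> D"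
    and c: "proper_off D I 4 c" and w_eq: "w = word hs c"
    using w(1) by (rule realizableE)
  let ?X = "bicolored D c \<alpha> \<beta>" and ?A = "filter (\<lambda>n. w ! n \<in> {\<alpha>, \<beta>}) [0..<length w]"
  have I: "fst ` set hs \<subseteq> I"
    using hs(1) \<open>set vs \<subseteq> I\<close> by (metis set_map)
  have A: "i \<in> set ?A \<longleftrightarrow> i < length hs \<and> hs ! i \<in> ?X" for i
    using hs(3) nth_mem[of i hs] by (auto simp: w_eq nth_word mem_bicolored simp del: nth_mem)
  have "\<exists>c'. proper_off D I 4 c' \<and> W (word hs c')"
  proof (rule kempe_sound[OF assms(1,3,4) hs(2,3) I c refl, where A = ?A])
    show "kempe W \<alpha> \<beta> ?A (word hs c)"
      using w(2) by (simp add: reduces_def w_eq)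
    show "j \<in> set ?A"
      if "i \<in> set ?A" "j < length hs" "(chain I ?X)\<^sup>*\<^sup>* (hs ! i) (hs ! j)" for i j
    proof -
      from that(3) have "hs ! j \<in> ?X"
        using that(1) A[of i] by cases (auto simp: chain_def)
      with that(2) A[of j] show ?thesis by blast
    qed
    show "distinct ?A"
      by simp
  qed (use A in blast)
  then obtain c' where "proper_off D I 4 c'" "W (word hs c')"
    by blast
  with hs show ?thesis
    unfolding realizable_def by (intro exI[of _ "word hs c'"]) auto
qed

section \<open>Renaming colours and exchanging half-edges\<close>

lemma canonical_perm:
  assumes "\<forall>i \<in> set w. i < m" 
  shows "\<exists>\<pi>. inj \<pi> \<and> (\<forall>i < m. \<pi> i < m) \<and> (\<forall>i < k. \<pi> i = i) \<and> canonical k w = map \<pi> w"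
  using assms
proof (induction k w rule: canonical.induct)
  case (1 k)
  show ?case by (rule exI[of _ id]) auto
next
  case (2 k i w)
  show ?case
  proof (cases "i < k")
    case True
    then obtain \<pi> where "inj \<pi>" "\<forall>n < m. \<pi> n < m" "\<forall>n < k. \<pi> n = n" "canonical k w = map \<pi> w"
      using "2.IH"(1) "2.prems" by auto
    with True show ?thesis by (intro exI[of _ \<pi>]) simp
  next
    case False
    \<comment> \<open>Here \<open>k \<le> i < m\<close>. The colour \<open>i\<close> is sent to
      \<open>k\<close>, which the permutation from the induction hypothesis keeps because it fixes
      all colours below \<open>Suc k\<close>.\<close>
    have bound: "\<forall>n < m. transpose i k n < m"
      using False "2.prems" by (auto simp: transpose_def)
    obtain \<pi> where \<pi>: "inj \<pi>" "\<forall>n < m. \<pi> n < m" "\<forall>n < Suc k. \<pi> n = n"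
      "canonical (Suc k) (map (transpose i k) w) = map \<pi> (map (transpose i k) w)"
      using "2.IH"(2)[OF False] "2.prems" bound by auto
    have "inj (\<lambda>n. \<pi> (transpose i k n))"
      using inj_compose[OF \<pi>(1) inj_on_transpose] by (simp add: comp_def)
    moreover have "transpose i k n = n" if "n < k" for n
      using that False by (auto simp: transpose_def)
    ultimately show ?thesis
      using False \<pi> bound by (intro exI[of _ "\<lambda>n. \<pi> (transpose i k n)"]) auto
  qed
qed

lemma canonical_in_canonical_words:
  "\<forall>i \<in> set w. i < 4 \<Longrightarrow> k \<le> 4 \<Longrightarrow> canonical k w \<in> set (canonical_words k (length w))"
proof (induction k w rule: canonical.induct)
  case (2 k i w)
  show ?case
  proof (cases "i < k")
    case True
    then have "max k (Suc i) = k" "i \<in> set [0..<min 4 (Suc k)]"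
      using 2 by auto
    moreover have "canonical k w \<in> set (canonical_words k (length w))"
      using 2 True by simp
    ultimately show ?thesis
      using True by (auto simp del: set_upt intro!: bexI[of _ i])
  next
    case False
    have "\<forall>n \<in> set (map (transpose i k) w). n < 4"
      using 2 False by (auto simp: transpose_def)
    then have "canonical (Suc k) (map (transpose i k) w) \<in> set (canonical_words (Suc k) (length w))"
      using "2.IH"(2)[OF False] "2.prems" False by simp
    moreover have "max k (Suc k) = Suc k" "k \<in> set [0..<min 4 (Suc k)]"
      using 2 False by auto
    ultimately show ?thesis
      using False by (auto simp del: set_upt intro!: bexI[of _ k])
  qed
qed simp

lemma word_comp: "word hs (\<pi> \<circ> c) = map \<pi> (word hs c)"
  by (simp add: word_def case_prod_beta)

lemma realizable_canonical:
  assumes "realizable D I vs w"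
  shows "realizable D I vs (canonical 0 w)"
proof -
  obtain hs c where hs: "map fst hs = vs" "distinct hs" "set hs \<subseteq> D"
    and c: "proper_off D I 4 c" and w_eq: "w = word hs c"
    using assms by (rule realizableE)
  have "\<forall>i \<in> set w. i < 4"
    using c hs(3) by (auto simp: w_eq word_def proper_off_def)
  then obtain \<pi> where "inj \<pi>" "\<forall>i < 4. \<pi> i < 4" "canonical 0 w = map \<pi> w"
    using canonical_perm by blast
  then show ?thesis
    using hs proper_off_comp[OF c, of \<pi>] unfolding realizable_def
    by (intro exI[of _ hs] exI[of _ "\<pi> \<circ> c"]) (auto simp: w_eq word_comp)
qed

lemma variants_map: "variants (map f w) = map (map f) (variants w)"
  by (cases w rule: variants.cases) simp_all

lemma realizable_variants:
  assumes "realizable D I [x, z, y, u, u, v, v] w" "w' \<in> set (variants w)"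
  shows "realizable D I [x, z, y, u, u, v, v] w'"
proof -
  obtain hs c where hs: "map fst hs = [x, z, y, u, u, v, v]" "distinct hs" "set hs \<subseteq> D"
    and c: "proper_off D I 4 c" and w: "w = word hs c"
    using assms(1) by (rule realizableE)
  obtain h1 h2 h3 h4 h5 h6 h7 where hs_eq: "hs = [h1, h2, h3, h4, h5, h6, h7]"
    using hs(1) by (auto simp: map_eq_Cons_conv)
  have word: "word hs' c = map (\<lambda>(a, b). c {a, b}) hs'" for hs'
    by (simp add: word_def)
  obtain hs' where hs': "w' = word hs' c" "hs' \<in> set (variants hs)"
    using assms(2) by (auto simp: w word variants_map)
  then have "map fst hs' = [x, z, y, u, u, v, v]" "distinct hs'" "set hs' \<subseteq> D"
    using hs unfolding hs_eq by auto
  with c hs'(1) show ?thesis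
    unfolding realizable_def by (intro exI[of _ hs'] exI[of _ c]) auto
qed

text \<open>Induction along the list: a word that matches the head up to \<open>variants\<close> and
  renaming makes the head itself realizable, and swaps lead from there to a realizable word won by
  the tail. For the empty list, \<open>won\<close> means \<open>completable\<close>.\<close>

lemma winning_sound:
  assumes "sym D" "{x, y, z, u, v} \<subseteq> I"
  shows "winning L \<Longrightarrow> realizable D I [x, z, y, u, u, v, v] w \<Longrightarrow> won L w \<Longrightarrow>
    \<exists>w'. realizable D I [x, z, y, u, u, v, v] w' \<and> completable w'"
proof (induction L arbitrary: w rule: winning.induct)
  case 1
  then show ?case by (auto simp: won_def)
next
  case (2 w0 \<alpha> \<beta> L)
  show ?case
  proof (cases "won L w")
    case True
    with 2 show ?thesis by auto
  next
    case False
    with "2.prems"(3) have "\<exists>w' \<in> set (variants w). w0 = canonical 0 w'"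
      by (auto simp: won_def)
    then have "realizable D I [x, z, y, u, u, v, v] w0"
      using "2.prems"(2) by (auto intro: realizable_variants realizable_canonical)
    then show ?thesis
      using realizable_reduces[OF assms(1), of "[x, z, y, u, u, v, v]" I \<alpha> \<beta> w0 "won L"] "2.prems"(1) "2.IH" assms(2)
      by auto
  qed
qed

subsection \<open>The configuration\<close>

lemma pair_graph_sym:
  assumes "pair_graph G"
  shows "(a, b) \<in> parcs G \<longleftrightarrow> (b, a) \<in> parcs G"
proof -
  interpret pair_graph G by fact
  show ?thesis by (blast intro: arcs_symmetric)
qed

text \<open>With nothing cut open, \<open>proper_off\<close> is ordinary properness, stated for arcs
  with a common tail instead of for sets of two vertices.\<close>

lemma proper_edge_coloring_iff:
  assumes "pair_graph G"
  shows "proper_edge_coloring G k c \<longleftrightarrow> proper_off (parcs G) {} k c"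
proof -
  note sym = pair_graph_sym[OF assms, THEN iffD1]
  show ?thesis
  proof
    assume c: "proper_edge_coloring G k c"
    show "proper_off (parcs G) {} k c"
      unfolding proper_off_def
    proof (intro conjI allI impI ballI)
      fix d assume "d \<in> parcs G"
      then have "{fst d, snd d} \<in> edges G"
        unfolding edges_def by force
      then have "c {fst d, snd d} < k"
        using c unfolding proper_edge_coloring_def by blast
      then show "case d of (a, b) \<Rightarrow> c {a, b} < k"
        by (simp add: case_prod_beta)
    next
      have meet: "c e \<noteq> c f" if "e \<in> edges G" "f \<in> edges G" "e \<noteq> f" "a \<in> e" "a \<in> f" for e f a
        using c that unfolding proper_edge_coloring_def by blast
      fix a b b' assume "(a, b) \<in> parcs G" "(a, b') \<in> parcs G" "b \<noteq> b'"
      then show "c {a, b} \<noteq> c {a, b'}"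
        by (intro meet[of _ _ a]) (auto simp: edges_def doubleton_eq_iff)
    qed
  next
    assume c: "proper_off (parcs G) {} k c"
    show "proper_edge_coloring G k c"
      unfolding proper_edge_coloring_def
    proof (intro conjI ballI impI)
      fix e assume "e \<in> edges G"
      with c show "c e < k"
        by (auto simp: proper_off_def edges_def)
    next
      fix e f assume "e \<in> edges G" "f \<in> edges G" and ef: "e \<noteq> f \<and> e \<inter> f \<noteq> {}"
      then obtain a where a: "a \<in> e" "a \<in> f"
        by blast
      have dart: "\<exists>b. g = {a, b} \<and> (a, b) \<in> parcs G" if "g \<in> edges G" "a \<in> g" for g
        using that sym by (auto simp: edges_def)
      obtain b b' where "e = {a, b}" "f = {a, b'}" "(a, b) \<in> parcs G" "(a, b') \<in> parcs G"
        using dart \<open>e \<in> edges G\<close> \<open>f \<in> edges G\<close> a by meson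
      with c ef show "c e \<noteq> c f"
        unfolding proper_off_def by blast
    qed
  qed
qed

section \<open>Neighbours, degrees and bounds on the chromatic index\<close>

lemma out_degree_eq_card_neighbours:
  "out_degree (with_proj G) a = card {b. (a, b) \<in> parcs G}"
proof -
  have "out_arcs (with_proj G) a = Pair a ` {b. (a, b) \<in> parcs G}"
    by (auto simp: out_arcs_def)
  then show ?thesis
    by (simp add: out_degree_def card_image inj_on_def)
qed

lemma one_more_element:
  assumes "card N = Suc (length ps)" "distinct ps" "set ps \<subseteq> N"
  obtains r where "N = set (r # ps)" "distinct (r # ps)"
proof -
  have "card (N - set ps) = 1"
    using assms by (simp add: card_Diff_subset distinct_card)
  then obtain r where "N - set ps = {r}"
    by (rule card_1_singletonE)
  with assms(2,3) show thesis
    by (intro that[of r]) auto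
qed

lemma two_more_elements:
  assumes "card N = Suc (Suc (length ps))" "distinct ps" "set ps \<subseteq> N"
  obtains r r' where "N = set (r # r' # ps)" "distinct (r # r' # ps)"
proof -
  have "card (N - set ps) = 2"
    using assms by (simp add: card_Diff_subset distinct_card)
  then obtain r' where "r' \<in> N - set ps"
    by (auto simp: card_2_iff)
  with assms have "card N = Suc (length (r' # ps))" "distinct (r' # ps)" "set (r' # ps) \<subseteq> N"
    by auto
  then obtain r where "N = set (r # r' # ps)" "distinct (r # r' # ps)"
    by (rule one_more_element)
  then show thesis
    by (rule that)
qed

lemma chromatic_index_le:
  "proper_edge_coloring G k c \<Longrightarrow> chromatic_index G \<le> k"
  unfolding chromatic_index_def by (intro Least_le) blast

lemma out_degree_le_chromatic_index:
  assumes "pair_graph G"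
  shows "out_degree (with_proj G) a \<le> chromatic_index G"
proof -
  obtain c where c: "proper_edge_coloring G (chromatic_index G) c"
    using chromatic_index_attained[OF assms] by blast
  have "inj_on c {e \<in> edges G. a \<in> e}"
    using c unfolding proper_edge_coloring_def inj_on_def by blast
  moreover have "c ` {e \<in> edges G. a \<in> e} \<subseteq> {..<chromatic_index G}"
    using c unfolding proper_edge_coloring_def by blast
  ultimately have "card {e \<in> edges G. a \<in> e} \<le> card {..<chromatic_index G}"
    by (rule card_inj_on_le) simp
  then show ?thesis
    by (simp add: out_degree_eq_card_edges[OF assms])
qed

lemma set_free: "i \<in> set (free cs) \<longleftrightarrow> i < 4 \<and> i \<notin> set cs"
proof -
  have "i < 4 \<longleftrightarrow> i = 0 \<or> i = 1 \<or> i = 2 \<or> i = 3"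
    by arith
  then show ?thesis
    by (auto simp: free_def)
qed

theorem proposition2p14:
  fixes G :: "'a pair_pre_digraph" and x y z u v :: 'a
  assumes "pair_graph G"
    and "Digraph_Component.connected (with_proj G)"
    and "max_degree G = 4"
    and "distinct [x, y, z, u, v]"
    and "{x, y} \<in> edges G" "{x, z} \<in> edges G" "{y, z} \<in> edges G"
      "{y, u} \<in> edges G" "{u, v} \<in> edges G"
    and "out_degree (with_proj G) x = 3" "out_degree (with_proj G) z = 3"
      "out_degree (with_proj G) v = 3"
    and "out_degree (with_proj G) y = 4" "out_degree (with_proj G) u = 4"
    and "chromatic_index (del_edge G {x, y}) = 4"
  shows "chromatic_index G = 4"
proof -
  note sym = pair_graph_sym[OF assms(1), THEN iffD1]
  note dist = assms(4)
  define N where "N a = {b. (a, b) \<in> parcs G}" for a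
  have N_iff: "b \<in> N a \<longleftrightarrow> (a, b) \<in> parcs G" for a b
    by (simp add: N_def)
  have edge_iff: "{a, b} \<in> edges G \<longleftrightarrow> (a, b) \<in> parcs G" for a b
    using sym by (auto simp: edges_def doubleton_eq_iff)
  have N_sym: "b \<in> N a \<longleftrightarrow> a \<in> N b" for a b
    using sym by (auto simp: N_iff)
  have adj: "y \<in> N x" "z \<in> N x" "z \<in> N y" "u \<in> N y" "v \<in> N u"
    using assms(5-9) by (simp_all add: edge_iff N_iff)
  have card: "card (N x) = 3" "card (N z) = 3" "card (N v) = 3" "card (N y) = 4" "card (N u) = 4"
    using assms(10-14) by (simp_all add: out_degree_eq_card_neighbours N_def)
  \<comment> \<open>The degrees leave one further neighbour at each of \<open>x\<close>,
    \<open>z\<close>, \<open>y\<close> and two at each of \<open>u\<close>, \<open>v\<close>. Those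
    of different vertices may coincide, and they may belong to the configuration.\<close>
  obtain s where s: "N x = set [s, y, z]" "distinct [s, y, z]"
    by (rule one_more_element[of "N x" "[y, z]"]) (use card adj N_sym dist in auto)
  obtain t where t: "N z = set [t, x, y]" "distinct [t, x, y]"
    by (rule one_more_element[of "N z" "[x, y]"]) (use card adj N_sym dist in auto)
  obtain w where w: "N y = set [w, x, z, u]" "distinct [w, x, z, u]"
    by (rule one_more_element[of "N y" "[x, z, u]"]) (use card adj N_sym dist in auto)
  obtain p1 p2 where p: "N u = set [p1, p2, y, v]" "distinct [p1, p2, y, v]"
    by (rule two_more_elements[of "N u" "[y, v]"]) (use card adj N_sym dist in auto)
  obtain q1 q2 where q: "N v = set [q1, q2, u]" "distinct [q1, q2, u]"
    by (rule two_more_elements[of "N v" "[u]"]) (use card adj N_sym dist in auto)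
  define J where "J = {{x, y}, {x, z}, {y, z}, {y, u}, {u, v}}"
  define D where "D = {(a, b) \<in> parcs G. {a, b} \<notin> J}"
  define I where "I = {x, y, z, u, v}"
  have "sym D"
    using sym by (auto simp: D_def sym_def insert_commute)
  have J: "{x, b} \<in> J \<longleftrightarrow> b \<in> {y, z}" "{z, b} \<in> J \<longleftrightarrow> b \<in> {x, y}"
    "{y, b} \<in> J \<longleftrightarrow> b \<in> {x, z, u}" "{u, b} \<in> J \<longleftrightarrow> b \<in> {y, v}" "{v, b} \<in> J \<longleftrightarrow> b = u" for b
    using dist unfolding J_def by (auto simp: doubleton_eq_iff)
  have D_iff: "(a, b) \<in> D \<longleftrightarrow> b \<in> N a \<and> {a, b} \<notin> J" for a b
    by (simp add: D_def N_iff)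
  have D: "(x, b) \<in> D \<longleftrightarrow> b = s" "(z, b) \<in> D \<longleftrightarrow> b = t" "(y, b) \<in> D \<longleftrightarrow> b = w"
    "(u, b) \<in> D \<longleftrightarrow> b \<in> {p1, p2}" "(v, b) \<in> D \<longleftrightarrow> b \<in> {q1, q2}" for b
    using s t w p q unfolding D_iff J by auto
  define hs where "hs = [(x, s), (z, t), (y, w), (u, p1), (u, p2), (v, q1), (v, q2)]"
  have hs: "map fst hs = [x, z, y, u, u, v, v]" "distinct hs" "set hs \<subseteq> D"
    using D dist p q by (auto simp: hs_def)

  have del: "pair_graph (del_edge G {x, y})"
    using assms(1) by (rule pair_graph_del_edge)
  obtain c where "proper_edge_coloring (del_edge G {x, y}) 4 c"
    using chromatic_index_attained[OF del] assms(15) by auto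
  then have c: "proper_off (parcs (del_edge G {x, y})) {} 4 c"
    by (simp add: proper_edge_coloring_iff[OF del])
  have D_sub: "D \<subseteq> parcs (del_edge G {x, y})"
    unfolding D_def J_def del_edge_def by force
  have "\<forall>i \<in> set (word hs c). i < 4"
    using c hs(3) D_sub by (auto simp: word_def proper_off_def)
  moreover have "length (word hs c) = 7"
    by (simp add: hs_def)
  ultimately have canonical: "canonical 0 (word hs c) \<in> set (canonical_words 0 7)"
    and "\<exists>\<pi>. inj \<pi> \<and> (\<forall>i < 4. \<pi> i < 4) \<and> (\<forall>i < 0. \<pi> i = i) \<and>
      canonical 0 (word hs c) = map \<pi> (word hs c)"
    using canonical_in_canonical_words[of "word hs c" 0] canonical_perm[of "word hs c" 4 0]
    by (simp_all del: canonical.simps canonical_words.simps)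
  then obtain \<pi> where \<pi>: "inj \<pi>" "\<forall>i < 4. \<pi> i < 4" "canonical 0 (word hs c) = map \<pi> (word hs c)"
    by blast
  \<comment> \<open>Renaming by \<pi> makes the boundary word canonical, as
    \<open>extendable_won\<close> demands.\<close>
  define c1 where "c1 = \<pi> \<circ> c"
  have c1: "proper_off (parcs (del_edge G {x, y})) {} 4 c1"
    unfolding c1_def using \<pi> proper_off_comp[OF c] by blast
  have word_c1: "word hs c1 \<in> set (canonical_words 0 7)"
    using canonical \<pi>(3) by (simp add: c1_def word_comp)
  have c1_star: "distinct (map (\<lambda>b. c1 {a, b}) bs)" "\<forall>i \<in> set (map (\<lambda>b. c1 {a, b}) bs). i < 4"
    if "distinct bs" "set bs \<subseteq> N a" "\<forall>b \<in> set bs. {a, b} \<noteq> {x, y}" for a bs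
  proof -
    have arcs: "(a, b) \<in> parcs (del_edge G {x, y})" if "b \<in> set bs" for b
      using \<open>set bs \<subseteq> N a\<close> \<open>\<forall>b \<in> set bs. {a, b} \<noteq> {x, y}\<close> that
      by (auto simp: del_edge_def N_def)
    show "\<forall>i \<in> set (map (\<lambda>b. c1 {a, b}) bs). i < 4"
      using c1 arcs unfolding proper_off_def by fastforce
    show "distinct (map (\<lambda>b. c1 {a, b}) bs)"
      unfolding distinct_map
    proof (intro conjI inj_onI)
      fix b b' assume "b \<in> set bs" "b' \<in> set bs" "c1 {a, b} = c1 {a, b'}"
      with c1 arcs show "b = b'"
        unfolding proper_off_def by blast
    qed fact
  qed
  have star_x: "distinct (map (\<lambda>b. c1 {x, b}) [s, z])" "\<forall>i \<in> set (map (\<lambda>b. c1 {x, b}) [s, z]). i < 4"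
    by (rule c1_star; use s dist in \<open>auto simp: doubleton_eq_iff\<close>)+
  have star_z: "distinct (map (\<lambda>b. c1 {z, b}) [t, x, y])" "\<forall>i \<in> set (map (\<lambda>b. c1 {z, b}) [t, x, y]). i < 4"
    by (rule c1_star; use t dist in \<open>auto simp: doubleton_eq_iff\<close>)+
  have star_y: "distinct (map (\<lambda>b. c1 {y, b}) [w, z, u])" "\<forall>i \<in> set (map (\<lambda>b. c1 {y, b}) [w, z, u]). i < 4"
    by (rule c1_star; use w dist in \<open>auto simp: doubleton_eq_iff\<close>)+
  have star_u: "distinct (map (\<lambda>b. c1 {u, b}) [p1, p2, y, v])" "\<forall>i \<in> set (map (\<lambda>b. c1 {u, b}) [p1, p2, y, v]). i < 4"
    by (rule c1_star; use p dist in \<open>auto simp: doubleton_eq_iff\<close>)+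
  have star_v: "distinct (map (\<lambda>b. c1 {v, b}) [q1, q2, u])"
    by (rule c1_star; use q dist in \<open>auto simp: doubleton_eq_iff\<close>)
  have swap: "{z, x} = {x, z}" "{z, y} = {y, z}" "{u, y} = {y, u}" "{v, u} = {u, v}" "{y, x} = {x, y}"
    by auto
  \<comment> \<open>The colours that \<open>c1\<close> itself gives to \<open>xz\<close>,
    \<open>yz\<close>, \<open>yu\<close>, \<open>uv\<close> witness that its boundary word is
    extendable.\<close>
  have "c1 {x, z} \<in> set (free [c1 {x, s}, c1 {z, t}])"
    "c1 {y, z} \<in> set (free [c1 {z, t}, c1 {x, z}, c1 {y, w}])"
    "c1 {y, u} \<in> set (free [c1 {y, w}, c1 {y, z}, c1 {u, p1}, c1 {u, p2}])"
    "c1 {u, v} \<in> set (free [c1 {y, u}, c1 {u, p1}, c1 {u, p2}, c1 {v, q1}, c1 {v, q2}])"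
    "c1 {u, p1} \<noteq> c1 {u, p2}" "c1 {v, q1} \<noteq> c1 {v, q2}"
    using star_x star_y star_z star_u star_v by (auto simp: set_free swap)
  then have "extendable (word hs c1)"
    unfolding hs_def word_def list.map case_prod_conv extendable.simps by (metis empty_iff)
  then have "won strategy (word hs c1)"
    using extendable_won word_c1 by blast
  moreover have "proper_off D I 4 c1"
    using c1 D_sub unfolding proper_off_def by blast
  then have "realizable D I [x, z, y, u, u, v, v] (word hs c1)"
    using hs unfolding realizable_def by (intro exI[of _ hs] exI[of _ c1]) simp
  ultimately obtain w' where "realizable D I [x, z, y, u, u, v, v] w'" and completable: "completable w'"
    using winning_sound[OF \<open>sym D\<close> _ winning_strategy, of x y z u v I] by (auto simp: I_def)
  then obtain hs' c2 where hs': "map fst hs' = [x, z, y, u, u, v, v]" "distinct hs'" "set hs' \<subseteq> D"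
    and c2: "proper_off D I 4 c2" and w': "w' = word hs' c2"
    by (elim realizableE)
  \<comment> \<open>The half-edges in \<open>hs'\<close> may come in an order other than in
    \<open>hs\<close>, so their outer ends get new names.\<close>
  obtain b1 b2 b3 b4 b5 b6 b7
    where hs'_eq: "hs' = [(x, b1), (z, b2), (y, b3), (u, b4), (u, b5), (v, b6), (v, b7)]"
    using hs'(1) by (auto simp: map_eq_Cons_conv)
  have b_D: "(x, b1) \<in> D" "(z, b2) \<in> D" "(y, b3) \<in> D" "(u, b4) \<in> D" "(u, b5) \<in> D"
    "(v, b6) \<in> D" "(v, b7) \<in> D"
    using hs'(3) by (simp_all add: hs'_eq)
  have "b4 \<noteq> b5" "b6 \<noteq> b7"
    using hs'(2) by (simp_all add: hs'_eq)
  then have N_eq: "N x = set [b1, y, z]" "N z = set [b2, x, y]" "N y = set [b3, x, z, u]"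
    "N u = set [b4, b5, y, v]" "N v = set [b6, b7, u]"
    using b_D unfolding D s(1) t(1) w(1) p(1) q(1) by auto
  obtain xz yz yu
    where "xz \<in> set (free [c2 {x, b1}, c2 {z, b2}])"
      "yz \<in> set (free [c2 {z, b2}, xz, c2 {y, b3}])"
      "yu \<in> set (free [c2 {y, b3}, yz, c2 {u, b4}, c2 {u, b5}])"
      "set (free [yu, c2 {u, b4}, c2 {u, b5}, c2 {v, b6}, c2 {v, b7}]) \<noteq> {}"
      "set (free [c2 {x, b1}, xz, c2 {y, b3}, yz, yu]) \<noteq> {}"
      "c2 {u, b4} \<noteq> c2 {u, b5}" "c2 {v, b6} \<noteq> c2 {v, b7}"
    using completable unfolding w' hs'_eq word_def list.map case_prod_conv completable.simps
    by (elim conjE bexE) (rule that; assumption)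
  moreover from this obtain uv xy
    where "uv \<in> set (free [yu, c2 {u, b4}, c2 {u, b5}, c2 {v, b6}, c2 {v, b7}])"
      "xy \<in> set (free [c2 {x, b1}, xz, c2 {y, b3}, yz, yu])"
    unfolding ex_in_conv[symmetric] by (elim exE) (rule that; assumption)
  ultimately have fill:
    "xz < 4" "xz \<noteq> c2 {x, b1}" "xz \<noteq> c2 {z, b2}"
    "yz < 4" "yz \<noteq> c2 {z, b2}" "yz \<noteq> xz" "yz \<noteq> c2 {y, b3}"
    "yu < 4" "yu \<noteq> c2 {y, b3}" "yu \<noteq> yz" "yu \<noteq> c2 {u, b4}" "yu \<noteq> c2 {u, b5}"
    "uv < 4" "uv \<noteq> yu" "uv \<noteq> c2 {u, b4}" "uv \<noteq> c2 {u, b5}" "uv \<noteq> c2 {v, b6}" "uv \<noteq> c2 {v, b7}"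
    "xy < 4" "xy \<noteq> c2 {x, b1}" "xy \<noteq> xz" "xy \<noteq> c2 {y, b3}" "xy \<noteq> yz" "xy \<noteq> yu"
    "c2 {u, b4} \<noteq> c2 {u, b5}" "c2 {v, b6} \<noteq> c2 {v, b7}"
    unfolding set_free by simp_all
  \<comment> \<open>\<open>c2\<close> is controlled only on \<open>D\<close>; on the five edges it
    is overwritten by the colours just found.\<close>
  define c3 where "c3 = c2({x, y} := xy, {x, z} := xz, {y, z} := yz, {y, u} := yu, {u, v} := uv)"
  have c3_J: "c3 {x, y} = xy" "c3 {x, z} = xz" "c3 {y, z} = yz" "c3 {y, u} = yu" "c3 {u, v} = uv"
    using dist by (simp_all add: c3_def doubleton_eq_iff)
  have c3_D: "c3 {a, b} = c2 {a, b}" if "(a, b) \<in> D" for a b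
    using that by (auto simp: c3_def D_iff J_def)
  note c3 = b_D[THEN c3_D] c3_J
  have stars: "distinct (map (\<lambda>b. c3 {x, b}) [b1, y, z])"
    "distinct (map (\<lambda>b. c3 {z, b}) [b2, x, y])"
    "distinct (map (\<lambda>b. c3 {y, b}) [b3, x, z, u])"
    "distinct (map (\<lambda>b. c3 {u, b}) [b4, b5, y, v])"
    "distinct (map (\<lambda>b. c3 {v, b}) [b6, b7, u])"
    using fill by (auto simp: c3 swap)
  have "c3 {a, b} < 4" if "(a, b) \<in> parcs G" for a b
  proof (cases "{a, b} \<in> J")
    case True
    then show ?thesis
      using fill by (auto simp: J_def c3)
  next
    case False
    with that have "(a, b) \<in> D"
      by (simp add: D_def)
    with c2 c3_D show ?thesis
      by (auto simp: proper_off_def)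
  qed
  \<comment> \<open>At a vertex of the configuration \<open>stars\<close> covers all incident edges;
    at any other vertex no edge of \<open>J\<close> occurs, so \<open>c3\<close> agrees with
    \<open>c2\<close> there.\<close>
  moreover have "c3 {a, b} \<noteq> c3 {a, b'}" if "b \<in> N a" "b' \<in> N a" "b \<noteq> b'" for a b b'
  proof (cases "a \<in> I")
    case True
    then have "inj_on (\<lambda>b. c3 {a, b}) (N a)"
      using stars unfolding I_def by (auto simp only: distinct_map N_eq insert_iff empty_iff)
    with that show ?thesis
      by (auto dest: inj_onD)
  next
    case False
    then have "{a, b} \<notin> J" "{a, b'} \<notin> J"
      by (auto simp: J_def I_def doubleton_eq_iff)
    with that have "(a, b) \<in> D" "(a, b') \<in> D"
      by (simp_all add: D_iff)
    with c2 c3_D False \<open>b \<noteq> b'\<close> show ?thesis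
      unfolding proper_off_def by metis
  qed
  ultimately have "proper_edge_coloring G 4 c3"
    unfolding proper_edge_coloring_iff[OF assms(1)] proper_off_def by (auto simp: N_iff)
  then have "chromatic_index G \<le> 4"
    by (rule chromatic_index_le)
  moreover have "4 \<le> chromatic_index G"
    using out_degree_le_chromatic_index[OF assms(1), of y] assms(13) by simp
  ultimately show ?thesis
    by simp
qed

end
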